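(* Let $\Omega_1,\dots,\Omega_p$ ($p\ge1$) and $S$ be nonempty closed convex subsets of $\mathbb{R}^n$ with $\Omega_i\cap S=\emptyset$ for every $i\in I:=\{1,\dots,p\}$, let $\alpha_i>0$ for $i\in I$, $\lambda>0$ and $v\in\mathbb{R}^n$. Let $$\varphi_v(x)=\sum_{i\in I}\alpha_i d(x;\Omega_i)+\frac{\lambda}{2}\|x\|^2-\langle v,x\rangle,\quad x\in\mathbb{R}^n,$$ and consider the generalized Weiszfeld algorithm for solving the problem $(P_v)$: $\min\{\varphi_v(x)\;|\;x\in S\}$, which from a starting point $x_0\in S$ produces $x_{k+1}=P(F_v(x_k);S)$ for $k=0,1,2,\dots$, with $F_v$ the mapping defined in the context. If $x_{k+1}\ne x_k$, then $\varphi_v(x_{k+1})<\varphi_v(x_k)$.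
   Context: $\mathbb{R}^n$ carries the Euclidean inner product $\langle\cdot,\cdot\rangle$ and norm $\|\cdot\|$. For a nonempty closed convex set $Q\subset\mathbb{R}^n$, $d(x;Q)=\inf\{\|x-w\|\;|\;w\in Q\}$ and $P(x;Q)$ is the Euclidean projection of $x$ to $Q$, i.e., the unique $w\in Q$ with $\|x-w\|=d(x;Q)$. The mapping $F_v:S\to\mathbb{R}^n$ is $$F_v(x)=\frac{\sum_{i\in I}\frac{\alpha_i P(x;\Omega_i)}{d(x;\Omega_i)}+v}{\sum_{i\in I}\frac{\alpha_i}{d(x;\Omega_i)}+\lambda},\quad x\in S.$$ *)

theory Defs
  imports "HOL-Analysis.Analysis"
begin

text \<open>For nonempty closed convex \<open>Q\<close>, the distance \<open>d(x; Q)\<close> is \<open>infdist x Q\<close> and the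
  Euclidean projection \<open>P(x; Q)\<close> is \<open>closest_point Q x\<close> (arguments in this order).
  The data are \<open>p\<close>, the sets \<open>\<Omega> 1, \<dots>, \<Omega> p\<close>, the weights \<open>\<alpha> 1, \<dots>, \<alpha> p\<close>,
  the regularization parameter \<open>lam\<close> and the vector \<open>v\<close>.\<close>

definition phi ::
  "nat \<Rightarrow> (nat \<Rightarrow> (real ^ 'n) set) \<Rightarrow> (nat \<Rightarrow> real) \<Rightarrow> real \<Rightarrow> real ^ 'n \<Rightarrow> real ^ 'n \<Rightarrow> real"
  where "phi p \<Omega> \<alpha> lam v x =
    (\<Sum>i\<in>{1..p}. \<alpha> i * infdist x (\<Omega> i)) + lam / 2 * (norm x)\<^sup>2 - v \<bullet> x"

text \<open>Only meaningful where no \<open>infdist x (\<Omega> i)\<close> vanishes, in particular on a set \<open>S\<close> disjoint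
  from the closed sets \<open>\<Omega> i\<close>; elsewhere the terms \<open>\<alpha> i / 0\<close> are \<open>0\<close> by convention.\<close>

definition weiszfeld_map ::
  "nat \<Rightarrow> (nat \<Rightarrow> (real ^ 'n) set) \<Rightarrow> (nat \<Rightarrow> real) \<Rightarrow> real \<Rightarrow> real ^ 'n \<Rightarrow> real ^ 'n \<Rightarrow> real ^ 'n"
  where "weiszfeld_map p \<Omega> \<alpha> lam v x =
    ((\<Sum>i\<in>{1..p}. (\<alpha> i *\<^sub>R closest_point (\<Omega> i) x) /\<^sub>R infdist x (\<Omega> i)) + v) /\<^sub>R
    ((\<Sum>i\<in>{1..p}. \<alpha> i / infdist x (\<Omega> i)) + lam)"

definition weiszfeld_sequence ::
  "nat \<Rightarrow> (nat \<Rightarrow> (real ^ 'n) set) \<Rightarrow> (nat \<Rightarrow> real) \<Rightarrow> real \<Rightarrow> real ^ 'n \<Rightarrow> (real ^ 'n) set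
    \<Rightarrow> (nat \<Rightarrow> real ^ 'n) \<Rightarrow> bool"
  where "weiszfeld_sequence p \<Omega> \<alpha> lam v S x \<longleftrightarrow>
    x 0 \<in> S \<and> (\<forall>k. x (Suc k) = closest_point S (weiszfeld_map p \<Omega> \<alpha> lam v (x k)))"

end

theory Submission
  imports Defs
begin

text \<open>
  The Weiszfeld step is a majorization-minimization step. At a point \<open>x\<close> of \<open>S\<close>, with projections
  \<open>c\<^sub>i\<close> of \<open>x\<close> onto \<open>\<Omega>\<^sub>i\<close> and distances \<open>d\<^sub>i = \<parallel>x - c\<^sub>i\<parallel> > 0\<close>, each distance function lies below a
  quadratic that touches it at \<open>x\<close>:
  \<open>d(y; \<Omega>\<^sub>i) \<le> \<parallel>y - c\<^sub>i\<parallel> \<le> \<parallel>y - c\<^sub>i\<parallel>\<^sup>2 / (2 d\<^sub>i) + d\<^sub>i / 2\<close>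
  (lemma \<open>infdist_diff_le_quadratic\<close>). Summing with the weights \<open>\<alpha>\<^sub>i\<close> and adding the regularization
  terms of \<open>\<phi>\<^sub>v\<close> bounds \<open>\<phi>\<^sub>v(y) - \<phi>\<^sub>v(x)\<close> by the increment from \<open>x\<close> to \<open>y\<close> of a single quadratic.
  Completing the square (lemma \<open>quadratic_increment_eq_centred\<close>) shows that this quadratic is
  centred at \<open>F\<^sub>v(x)\<close>: the increment is a positive multiple of \<open>\<parallel>y - F\<^sub>v(x)\<parallel>\<^sup>2 - \<parallel>x - F\<^sub>v(x)\<parallel>\<^sup>2\<close>
  (lemma \<open>phi_diff_le_centred_quadratic\<close>). The next iterate is the unique point of \<open>S\<close> nearest to
  \<open>F\<^sub>v(x)\<close>, so if it differs from \<open>x\<close>, which also lies in \<open>S\<close>, then it is strictly nearer to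
  \<open>F\<^sub>v(x)\<close> than \<open>x\<close> is, and the bound is negative.
\<close>

text \<open>The tangent-parabola bound \<open>t \<le> t\<^sup>2 / (2 d) + d / 2\<close>, which is \<open>(t - d)\<^sup>2 \<ge> 0\<close>, taken at
  \<open>d = infdist x A\<close> and \<open>t = \<parallel>y - c\<parallel>\<close>, where \<open>c\<close> is the point of \<open>A\<close> nearest to \<open>x\<close>. The
  parabola touches \<open>t\<close> at \<open>t = d = \<parallel>x - c\<parallel>\<close>, so the bound loses nothing when it is stated for
  the increments from \<open>x\<close> to \<open>y\<close>.\<close>

lemma infdist_diff_le_quadratic:
  fixes A :: "'a::euclidean_space set"
  assumes "closed A" "A \<noteq> {}" "x \<notin> A"
  defines "c \<equiv> closest_point A x"
  shows "infdist y A - infdist x A \<le> ((norm (y - c))\<^sup>2 - (norm (x - c))\<^sup>2) / (2 * infdist x A)"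
proof -
  define d where "d = infdist x A"
  define t where "t = norm (y - c)"
  have "d > 0"
    unfolding d_def using assms by (simp add: infdist_pos_not_in_closed)
  have "c \<in> A"
    unfolding c_def using assms by (simp add: closest_point_in_set)
  then have "infdist y A \<le> t"
    unfolding t_def by (metis infdist_le dist_norm)
  moreover have "norm (x - c) = d"
    unfolding d_def c_def using assms
    by (simp add: infdist_eq_setdist setdist_closest_point flip: dist_norm)
  moreover have "t - d \<le> (t\<^sup>2 - d\<^sup>2) / (2 * d)"
  proof -
    have "(t - d) * (2 * d) \<le> t\<^sup>2 - d\<^sup>2"
      using zero_le_power2[of "t - d"] by (simp add: power2_eq_square algebra_simps)
    then show ?thesis
      using \<open>d > 0\<close> by (simp add: pos_le_divide_eq)
  qed
  ultimately show ?thesis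
    by (simp flip: d_def t_def)
qed

lemma norm_diff_squared_increment:
  fixes x y z :: "'a::real_inner"
  shows "(norm (y - z))\<^sup>2 - (norm (x - z))\<^sup>2 = (norm y)\<^sup>2 - (norm x)\<^sup>2 - 2 * (z \<bullet> (y - x))"
  by (simp add: power2_norm_eq_inner inner_diff_left inner_diff_right inner_commute)

text \<open>A weighted sum of squared distances, regularized and tilted by \<open>v\<close>, is up to a constant one
  multiple of the squared distance to \<open>z\<close>: both sides have the same quadratic part, and the choice
  of \<open>z\<close> makes their linear parts agree. Taking increments makes the constant disappear.\<close>

lemma quadratic_increment_eq_centred:
  fixes c :: "'i \<Rightarrow> 'a::real_inner"
  assumes "W = sum w I + lam" "W \<noteq> 0" "z = ((\<Sum>i\<in>I. w i *\<^sub>R c i) + v) /\<^sub>R W"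
  shows "(\<Sum>i\<in>I. w i / 2 * ((norm (y - c i))\<^sup>2 - (norm (x - c i))\<^sup>2))
      + lam / 2 * ((norm y)\<^sup>2 - (norm x)\<^sup>2) - v \<bullet> (y - x)
    = W / 2 * ((norm (y - z))\<^sup>2 - (norm (x - z))\<^sup>2)"
proof -
  define N where "N = (norm y)\<^sup>2 - (norm x)\<^sup>2"
  have "W *\<^sub>R z = (\<Sum>i\<in>I. w i *\<^sub>R c i) + v"
    using assms by simp
  then have "(W *\<^sub>R z) \<bullet> (y - x) = ((\<Sum>i\<in>I. w i *\<^sub>R c i) + v) \<bullet> (y - x)"
    by (rule arg_cong)
  then have z: "W * (z \<bullet> (y - x)) = (\<Sum>i\<in>I. w i * (c i \<bullet> (y - x))) + v \<bullet> (y - x)"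
    by (simp only: inner_add_left inner_sum_left inner_scaleR_left)
  have "(\<Sum>i\<in>I. w i / 2 * ((norm (y - c i))\<^sup>2 - (norm (x - c i))\<^sup>2))
      = (\<Sum>i\<in>I. w i * (N / 2) - w i * (c i \<bullet> (y - x)))"
    by (intro sum.cong refl) (simp add: norm_diff_squared_increment N_def field_simps)
  also have "\<dots> = sum w I * (N / 2) - (\<Sum>i\<in>I. w i * (c i \<bullet> (y - x)))"
    by (simp add: sum_subtractf sum_distrib_right)
  finally have "(\<Sum>i\<in>I. w i / 2 * ((norm (y - c i))\<^sup>2 - (norm (x - c i))\<^sup>2))
      + lam / 2 * N - v \<bullet> (y - x) = W * (N / 2) - W * (z \<bullet> (y - x))"
    unfolding z by (simp add: assms(1) algebra_simps)
  also have "\<dots> = W / 2 * ((norm (y - z))\<^sup>2 - (norm (x - z))\<^sup>2)"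
    by (simp add: norm_diff_squared_increment N_def field_simps)
  finally show ?thesis
    by (simp add: N_def)
qed

text \<open>The weights \<open>\<alpha>\<^sub>i / d\<^sub>i\<close> in the Weiszfeld map are the curvatures of the majorizing parabolas, so
  \<open>F\<^sub>v(x)\<close> is the centre \<open>z\<close> of the previous lemma.\<close>

lemma phi_diff_le_centred_quadratic:
  fixes x y v :: "real ^ 'n"
  assumes \<Omega>: "\<And>i. i \<in> {1..p} \<Longrightarrow> closed (\<Omega> i) \<and> \<Omega> i \<noteq> {} \<and> x \<notin> \<Omega> i"
    and \<alpha>: "\<And>i. i \<in> {1..p} \<Longrightarrow> \<alpha> i \<ge> 0"
    and W: "W = (\<Sum>i\<in>{1..p}. \<alpha> i / infdist x (\<Omega> i)) + lam" "W \<noteq> 0"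
  defines "z \<equiv> weiszfeld_map p \<Omega> \<alpha> lam v x"
  shows "phi p \<Omega> \<alpha> lam v y - phi p \<Omega> \<alpha> lam v x
    \<le> W / 2 * ((norm (y - z))\<^sup>2 - (norm (x - z))\<^sup>2)"
proof -
  define w where "w i = \<alpha> i / infdist x (\<Omega> i)" for i
  define c where "c i = closest_point (\<Omega> i) x" for i
  have "\<alpha> i * (infdist y (\<Omega> i) - infdist x (\<Omega> i))
      \<le> w i / 2 * ((norm (y - c i))\<^sup>2 - (norm (x - c i))\<^sup>2)" if "i \<in> {1..p}" for i
    using mult_left_mono[OF infdist_diff_le_quadratic[of "\<Omega> i" x y] \<alpha>[OF that]] \<Omega>[OF that]
    by (simp add: w_def c_def mult.commute)
  then have "(\<Sum>i\<in>{1..p}. \<alpha> i * (infdist y (\<Omega> i) - infdist x (\<Omega> i)))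
      \<le> (\<Sum>i\<in>{1..p}. w i / 2 * ((norm (y - c i))\<^sup>2 - (norm (x - c i))\<^sup>2))"
    by (rule sum_mono)
  moreover have "phi p \<Omega> \<alpha> lam v y - phi p \<Omega> \<alpha> lam v x
      = (\<Sum>i\<in>{1..p}. \<alpha> i * (infdist y (\<Omega> i) - infdist x (\<Omega> i)))
        + lam / 2 * ((norm y)\<^sup>2 - (norm x)\<^sup>2) - v \<bullet> (y - x)"
    by (simp add: phi_def right_diff_distrib sum_subtractf inner_diff_right)
  moreover have "(\<Sum>i\<in>{1..p}. w i / 2 * ((norm (y - c i))\<^sup>2 - (norm (x - c i))\<^sup>2))
      + lam / 2 * ((norm y)\<^sup>2 - (norm x)\<^sup>2) - v \<bullet> (y - x)
    = W / 2 * ((norm (y - z))\<^sup>2 - (norm (x - z))\<^sup>2)"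
  proof (rule quadratic_increment_eq_centred)
    show "W = sum w {1..p} + lam"
      using W by (simp add: w_def)
    show "z = ((\<Sum>i\<in>{1..p}. w i *\<^sub>R c i) + v) /\<^sub>R W"
      by (simp add: z_def weiszfeld_map_def w_def c_def W(1) divide_inverse mult.commute)
  qed (rule W(2))
  ultimately show ?thesis
    by linarith
qed

lemma weiszfeld_sequence_in_feasible_set:
  assumes "weiszfeld_sequence p \<Omega> \<alpha> lam v S x" "closed S"
  shows "x k \<in> S"
proof (cases k)
  case 0
  with assms show ?thesis
    by (simp add: weiszfeld_sequence_def)
next
  case (Suc n)
  moreover have "S \<noteq> {}"
    using assms by (auto simp: weiszfeld_sequence_def)
  ultimately show ?thesis
    using assms by (simp add: weiszfeld_sequence_def closest_point_in_set)
qed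

theorem theorem5p1:
  fixes p :: nat
    and \<Omega> :: "nat \<Rightarrow> (real ^ 'n) set"
    and S :: "(real ^ 'n) set"
    and \<alpha> :: "nat \<Rightarrow> real"
    and lam :: real
    and v :: "real ^ 'n"
    and x :: "nat \<Rightarrow> real ^ 'n"
    and k :: nat
  assumes "p \<ge> 1"
    and "\<And>i. i \<in> {1..p} \<Longrightarrow> \<Omega> i \<noteq> {} \<and> closed (\<Omega> i) \<and> convex (\<Omega> i)"
    and "S \<noteq> {}" and "closed S" and "convex S"
    and "\<And>i. i \<in> {1..p} \<Longrightarrow> \<Omega> i \<inter> S = {}"
    and "\<And>i. i \<in> {1..p} \<Longrightarrow> \<alpha> i > 0"
    and "lam > 0"
    and "weiszfeld_sequence p \<Omega> \<alpha> lam v S x"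
    and "x (Suc k) \<noteq> x k"
  shows "phi p \<Omega> \<alpha> lam v (x (Suc k)) < phi p \<Omega> \<alpha> lam v (x k)"
proof -
  define z where "z = weiszfeld_map p \<Omega> \<alpha> lam v (x k)"
  define W where "W = (\<Sum>i\<in>{1..p}. \<alpha> i / infdist (x k) (\<Omega> i)) + lam"
  have xk: "x k \<in> S"
    using assms by (simp add: weiszfeld_sequence_in_feasible_set)
  have "W > 0"
    unfolding W_def using assms(7,8)
    by (intro add_nonneg_pos sum_nonneg divide_nonneg_nonneg) (auto simp: infdist_nonneg less_imp_le)
  have next_iterate: "x (Suc k) = closest_point S z"
    using assms(9) by (simp add: z_def weiszfeld_sequence_def)
  have "dist z (x (Suc k)) < dist z (x k)"
    unfolding next_iterate
    by (rule closest_point_lt[OF \<open>convex S\<close> \<open>closed S\<close> xk])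
      (use assms(10) next_iterate in simp)
  then have "(norm (x (Suc k) - z))\<^sup>2 < (norm (x k - z))\<^sup>2"
    by (simp add: dist_norm norm_minus_commute power_strict_mono)
  then have "W / 2 * ((norm (x (Suc k) - z))\<^sup>2 - (norm (x k - z))\<^sup>2) < 0"
    using \<open>W > 0\<close> by (simp add: mult_pos_neg)
  moreover have "phi p \<Omega> \<alpha> lam v (x (Suc k)) - phi p \<Omega> \<alpha> lam v (x k)
      \<le> W / 2 * ((norm (x (Suc k) - z))\<^sup>2 - (norm (x k - z))\<^sup>2)"
    unfolding z_def
  proof (rule phi_diff_le_centred_quadratic)
    show "closed (\<Omega> i) \<and> \<Omega> i \<noteq> {} \<and> x k \<notin> \<Omega> i" if "i \<in> {1..p}" for i
      using assms(2,6)[OF that] xk by blast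
    show "\<alpha> i \<ge> 0" if "i \<in> {1..p}" for i
      using assms(7)[OF that] by simp
    show "W \<noteq> 0"
      using \<open>W > 0\<close> by simp
  qed (rule W_def)
  ultimately show ?thesis
    by linarith
qed

end
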